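(* Let $\mathcal{A}\in\mathbb{C}_{t}^{m,n}$, let $b\in\mathbb{C}^m$, and let $\mathcal{A}^{(1)_k}\in\mathbb{C}_k^{n,m}$ denote an order $k$ $\{1\}$ inverse of $\mathcal{A}$. If the equation $\mathcal{A}\cdot x^{t-1}=b$ in the unknown $x\in\mathbb{C}^n$ is solvable, then $x=\mathcal{A}^{(1)_k}\cdot (b^{[\frac{1}{s}]})^{k-1}$ is a solution of it, where $s=(t-1)(k-1)$.
   Context: $[n]=\{1,\ldots,n\}$. $\mathbb{C}_{t}^{m,n}$ is the set of all order $t$ complex tensors $\mathcal{A}=(a_{i_1\cdots i_t})$ of dimension $m\times n\times\cdots\times n$ ($i_1\in[m]$, $i_2,\ldots,i_t\in[n]$); an order 2 tensor is a matrix. For $x\in\mathbb{C}^n$, $\mathcal{A}\cdot x^{t-1}\in\mathbb{C}^m$ has components $(\mathcal{A}\cdot x^{t-1})_i=\sum_{i_2,\ldots,i_t\in[n]}a_{ii_2\cdots i_t}x_{i_2}\cdots x_{i_t}$. For a vector $x$, $x^{[r]}=(x_1^r,\ldots,x_n^r)^{\mathrm T}$ (componentwise power; for $r=1/s$ this is the componentwise $s$-th root, no branch being specified in the paper). General tensor product: for $\mathcal{A}\in\mathbb{C}_t^{m,n}$, $\mathcal{B}\in\mathbb{C}_k^{n,m}$, $\mathcal{A}\mathcal{B}\in\mathbb{C}_{(t-1)(k-1)+1}^{m,m}$ has entries $(\mathcal{A}\mathcal{B})_{i\alpha_1\cdots\alpha_{t-1}}=\sum_{i_2,\ldots,i_t\in[n]}a_{ii_2\cdots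 i_t}b_{i_2\alpha_1}\cdots b_{i_t\alpha_{t-1}}$, $i\in[m]$, $\alpha_1,\ldots,\alpha_{t-1}\in[m]^{k-1}$. $\mathcal{X}\in\mathbb{C}_k^{n,m}$ is an order $k$ $\{1\}$ inverse of $\mathcal{A}\in\mathbb{C}_t^{m,n}$ if $\mathcal{A}\mathcal{X}\cdot[(\mathcal{A}\cdot y^{t-1})^{[\frac1s]}]^s=\mathcal{A}\cdot y^{t-1}$ for all $y\in\mathbb{C}^n$, where $s=(t-1)(k-1)$. *)

theory Defs
  imports "HOL-Analysis.Analysis"
begin

text \<open>
  An entry \<open>a i\<^sub>1 i\<^sub>2 \<dots> i\<^sub>t\<close> of a tensor of dimension \<open>m \<times> n \<times> \<cdots> \<times> n\<close> is written
  \<open>A i\<^sub>1 [i\<^sub>2, \<dots>, i\<^sub>t]\<close>. The index ranges are finite types; the order is not part of the type,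
  and membership in \<open>tensors t\<close> says that \<open>A\<close> is supported on index lists of length \<open>t - 1\<close>.
\<close>

type_synonym ('m, 'n) tensor = "'m \<Rightarrow> 'n list \<Rightarrow> complex"

definition tensors :: "nat \<Rightarrow> ('m, 'n) tensor set" where
  "tensors t = {A. \<forall>i js. length js \<noteq> t - 1 \<longrightarrow> A i js = 0}"

definition tensor_apply ::
  "nat \<Rightarrow> ('m::finite, 'n::finite) tensor \<Rightarrow> complex ^ 'n \<Rightarrow> complex ^ 'm" where
  "tensor_apply t A x = (\<chi> i. \<Sum>js\<in>{js. length js = t - 1}. A i js * (\<Prod>l<t - 1. x $ (js ! l)))"

text \<open>
  The multi-indices \<open>\<alpha>\<^sub>1, \<alpha>\<^sub>2, \<dots>\<close> (\<open>t - 1\<close> of them), each of length \<open>k - 1\<close> in an entry of the general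
  product are concatenated to a single index list \<open>\<beta>\<close> of length \<open>(t - 1) * (k - 1)\<close>;
  \<open>block k \<beta> l\<close> recovers them, counting \<open>l\<close> from 0.
\<close>

definition block :: "nat \<Rightarrow> 'a list \<Rightarrow> nat \<Rightarrow> 'a list" where
  "block k \<beta> l = take (k - 1) (drop (l * (k - 1)) \<beta>)"

definition tensor_prod ::
  "nat \<Rightarrow> nat \<Rightarrow> ('m::finite, 'n::finite) tensor \<Rightarrow> ('n, 'm) tensor \<Rightarrow> ('m, 'm) tensor" where
  "tensor_prod t k A B = (\<lambda>i \<beta>.
     if length \<beta> = (t - 1) * (k - 1)
     then \<Sum>js\<in>{js. length js = t - 1}. A i js * (\<Prod>l<t - 1. B (js ! l) (block k \<beta> l))
     else 0)"

lemma tensor_prod_in_tensors: "tensor_prod t k A B \<in> tensors ((t - 1) * (k - 1) + 1)"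
  by (simp add: tensors_def tensor_prod_def)

definition vec_pow :: "complex ^ 'n \<Rightarrow> nat \<Rightarrow> complex ^ 'n" where
  "vec_pow x r = (\<chi> i. (x $ i) ^ r)"

text \<open>
  The complex \<open>s\<close>-th root is multivalued, so the componentwise root of a vector is rendered by an arbitrary
  function \<open>rt\<close> selecting a componentwise \<open>s\<close>-th root of every vector. Applying one branch
  of the scalar root to all components is a special case, and so is the principal branch.
\<close>

definition vec_root :: "nat \<Rightarrow> (complex ^ 'n \<Rightarrow> complex ^ 'n) \<Rightarrow> bool" where
  "vec_root s rt \<longleftrightarrow> (\<forall>v. vec_pow (rt v) s = v)"

lemma vec_root_componentwise:
  assumes "\<And>z. f z ^ s = z"
  shows "vec_root s (\<lambda>v. \<chi> i. f (v $ i))"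
  using assms by (simp add: vec_root_def vec_pow_def)

lemma vec_root_principal:
  assumes "s > 0"
  shows "vec_root s (\<lambda>v. \<chi> i. (v $ i) powr (1 / of_nat s))"
proof (rule vec_root_componentwise)
  fix z :: complex
  show "(z powr (1 / of_nat s)) ^ s = z"
    using assms by (cases "z = 0") (auto simp: powr_def exp_of_nat_mult [symmetric])
qed

text \<open>
  \<open>X\<close> is an order \<open>k\<close> \<open>{1}\<close> inverse of the order \<open>t\<close> tensor \<open>A\<close>, with respect to the
  selection \<open>rt\<close> of componentwise roots of order \<open>(t - 1) * (k - 1)\<close>.
\<close>

definition one_inverse ::
  "nat \<Rightarrow> nat \<Rightarrow> (complex ^ 'm \<Rightarrow> complex ^ 'm) \<Rightarrow>
   ('m::finite, 'n::finite) tensor \<Rightarrow> ('n, 'm) tensor \<Rightarrow> bool" where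
  "one_inverse t k rt A X \<longleftrightarrow>
     X \<in> tensors k \<and>
     (\<forall>y. tensor_apply ((t - 1) * (k - 1) + 1) (tensor_prod t k A X) (rt (tensor_apply t A y))
          = tensor_apply t A y)"

end

theory Submission
  imports Defs
begin

text \<open>
  The general product is compatible with application to a vector, \<open>(A X) \<cdot> v\<^sup>s = A \<cdot> (X \<cdot> v\<^sup>k\<^sup>-\<^sup>1)\<^sup>t\<^sup>-\<^sup>1\<close>:
  cutting an index list of length \<open>(t - 1) * (k - 1)\<close> into blocks turns the sum over such
  lists into a product of sums. With \<open>v\<close> the selected root of \<open>b = A \<cdot> y\<^sup>t\<^sup>-\<^sup>1\<close>, the defining equation
  of a \<open>{1}\<close> inverse is then the claim.
\<close>

text \<open>Cutting a list after its first \<open>a\<close> entries is a bijection onto pairs of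
  lists of lengths \<open>a\<close> and \<open>b\<close>, inverse to \<open>@\<close>. This lets the
  next induction peel off one block.\<close>

lemma sum_lists_length_add:
  fixes g :: "'a list \<Rightarrow> 'b::comm_monoid_add"
  shows "(\<Sum>\<beta> | length \<beta> = a + b. g \<beta>) = (\<Sum>\<beta> | length \<beta> = a. \<Sum>\<gamma> | length \<gamma> = b. g (\<beta> @ \<gamma>))"
proof -
  have "(\<Sum>\<beta> | length \<beta> = a + b. g \<beta>)
      = (\<Sum>(\<beta>, \<gamma>) \<in> {\<beta>. length \<beta> = a} \<times> {\<gamma>. length \<gamma> = b}. g (\<beta> @ \<gamma>))"
    by (rule sum.reindex_bij_witness
          [where i = "\<lambda>(\<beta>, \<gamma>). \<beta> @ \<gamma>" and j = "\<lambda>\<beta>. (take a \<beta>, drop a \<beta>)"]) auto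
  then show ?thesis
    by (simp add: sum.cartesian_product)
qed

text \<open>Distributivity: expanding the product picks one \<open>\<gamma>\<close> from each
  factor, and the \<open>p\<close> picks, concatenated, form exactly one \<open>\<beta>\<close>. The
  induction appends the new block at the end, so the earlier blocks keep their positions.\<close>

lemma prod_sum_lists_blocks:
  fixes f :: "nat \<Rightarrow> 'a list \<Rightarrow> 'b::comm_semiring_1"
  shows "(\<Prod>l<p. \<Sum>\<gamma> | length \<gamma> = k - 1. f l \<gamma>)
       = (\<Sum>\<beta> | length \<beta> = p * (k - 1). \<Prod>l<p. f l (block k \<beta> l))"
proof (induction p)
  case 0
  then show ?case by simp
next
  case (Suc p)
  have block_append: "block k (\<beta> @ \<gamma>) l = block k \<beta> l"
    if "length \<beta> = p * (k - 1)" "l < p" for \<beta> \<gamma> :: "'a list" and l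
  proof -
    \<comment> \<open>Block \<open>l\<close> ends at position \<open>(l + 1) * (k - 1)\<close>,
      still inside \<open>\<beta>\<close>, so it never reaches \<open>\<gamma>\<close>.\<close>
    have "l * (k - 1) + (k - 1) \<le> p * (k - 1)"
      using mult_le_mono1[of "Suc l" p "k - 1"] that(2) by simp
    then show ?thesis using that(1) by (simp add: block_def)
  qed
  have block_last: "block k (\<beta> @ \<gamma>) p = \<gamma>"
    if "length \<beta> = p * (k - 1)" "length \<gamma> = k - 1" for \<beta> \<gamma> :: "'a list"
    using that by (simp add: block_def)
  have "(\<Sum>\<beta> | length \<beta> = Suc p * (k - 1). \<Prod>l<Suc p. f l (block k \<beta> l))
      = (\<Sum>\<beta> | length \<beta> = p * (k - 1). \<Sum>\<gamma> | length \<gamma> = k - 1.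
          \<Prod>l<Suc p. f l (block k (\<beta> @ \<gamma>) l))"
    using sum_lists_length_add[where a = "p * (k - 1)" and b = "k - 1"] by (simp add: add.commute)
  also have "\<dots> = (\<Sum>\<beta> | length \<beta> = p * (k - 1). \<Sum>\<gamma> | length \<gamma> = k - 1.
          (\<Prod>l<p. f l (block k \<beta> l)) * f p \<gamma>)"
    by (intro sum.cong refl) (simp add: block_append block_last)
  also have "\<dots> = (\<Prod>l<Suc p. \<Sum>\<gamma> | length \<gamma> = k - 1. f l \<gamma>)"
    by (simp add: Suc.IH sum_product del: One_nat_def)
  finally show ?case by simp
qed

text \<open>The blocks tile \<open>\<beta>\<close>: block \<open>l\<close> holds the positions from
  \<open>l * (k - 1)\<close> up to, but excluding, \<open>(l + 1) * (k - 1)\<close>, so the double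
  product visits each entry once.\<close>

lemma prod_blocks:
  assumes "length \<beta> = p * (k - 1)"
  shows "(\<Prod>l<p. \<Prod>r<k - 1. g (block k \<beta> l ! r)) = (\<Prod>j<p * (k - 1). g (\<beta> ! j))"
proof -
  have "(\<Prod>r<k - 1. g (block k \<beta> l ! r)) = (\<Prod>j = l * (k - 1)..<l * (k - 1) + (k - 1). g (\<beta> ! j))"
    if "l < p" for l
  proof -
    \<comment> \<open>Indexing into \<open>drop\<close> is a plain shift only if no more than the
      whole list is dropped.\<close>
    have "l * (k - 1) \<le> length \<beta>"
      using that assms by simp
    then have "(\<Prod>r<k - 1. g (block k \<beta> l ! r)) = (\<Prod>r<k - 1. g (\<beta> ! (r + l * (k - 1))))"
      by (simp add: block_def add.commute)
    then show ?thesis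
      using prod.shift_bounds_nat_ivl[of "\<lambda>j. g (\<beta> ! j)" 0 "l * (k - 1)" "k - 1"]
      by (simp add: atLeast0LessThan add.commute)
  qed
  then show ?thesis
    by (simp add: prod.nat_group[symmetric])
qed

lemma tensor_apply_tensor_prod:
  fixes A :: "('m::finite, 'n::finite) tensor" and X :: "('n, 'm) tensor"
  shows "tensor_apply ((t - 1) * (k - 1) + 1) (tensor_prod t k A X) v
       = tensor_apply t A (tensor_apply k X v)"
proof (subst vec_eq_iff, rule allI)
  fix i
  let ?s = "(t - 1) * (k - 1)"
  have "tensor_apply t A (tensor_apply k X v) $ i
      = (\<Sum>js | length js = t - 1. A i js *
          (\<Sum>\<beta> | length \<beta> = ?s. \<Prod>l<t - 1.
            X (js ! l) (block k \<beta> l) * (\<Prod>r<k - 1. v $ (block k \<beta> l ! r))))"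
    by (simp add: tensor_apply_def prod_sum_lists_blocks del: One_nat_def)
  \<comment> \<open>The \<open>v\<close> factors of all blocks merge into one monomial in
    \<open>\<beta>\<close> that is free of \<open>js\<close>; after the swap it factors out, and the
    sum over \<open>js\<close> left behind is an entry of the product tensor.\<close>
  also have "\<dots> = (\<Sum>js | length js = t - 1. \<Sum>\<beta> | length \<beta> = ?s.
          A i js * (\<Prod>l<t - 1. X (js ! l) (block k \<beta> l)) * (\<Prod>j<?s. v $ (\<beta> ! j)))"
    by (simp add: prod.distrib prod_blocks sum_distrib_left mult.assoc del: One_nat_def)
  also have "\<dots> = (\<Sum>\<beta> | length \<beta> = ?s. \<Sum>js | length js = t - 1.
          A i js * (\<Prod>l<t - 1. X (js ! l) (block k \<beta> l)) * (\<Prod>j<?s. v $ (\<beta> ! j)))"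
    by (rule sum.swap)
  \<comment> \<open>The order \<open>?s + 1\<close> gives index lists of length \<open>?s\<close>,
    so the length test in \<open>tensor_prod\<close> succeeds on every summand.\<close>
  also have "\<dots> = tensor_apply (?s + 1) (tensor_prod t k A X) v $ i"
    by (simp add: tensor_apply_def tensor_prod_def sum_distrib_right)
  finally show "tensor_apply (?s + 1) (tensor_prod t k A X) v $ i
      = tensor_apply t A (tensor_apply k X v) $ i" ..
qed

theorem proposition2p2:
  fixes A :: "('m::finite, 'n::finite) tensor"
    and X :: "('n, 'm) tensor"
    and b :: "complex ^ 'm"
    and rt :: "complex ^ 'm \<Rightarrow> complex ^ 'm"
    and t k :: nat
  assumes "t \<ge> 2" and "k \<ge> 2"
    and "A \<in> tensors t"
    and "vec_root ((t - 1) * (k - 1)) rt"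
    and "one_inverse t k rt A X"
    and "\<exists>x. tensor_apply t A x = b"
  shows "tensor_apply t A (tensor_apply k X (rt b)) = b"
  using assms(5,6) unfolding one_inverse_def tensor_apply_tensor_prod by blast

end
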